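(* Let $d > 3$ and let $m$ be an integer with $2 \le m \le d-1$ and $$m(d+1-m) \le \left(\frac{d^2-3d+4}{2(d-2)}\right)^2 .$$ Then, up to similarity, there exist exactly two (mutually non-similar) non-regular, non-rectangular, orthocentric, equiradial $d$-simplices whose orthocenter has barycentric coordinates $a_1,\dots,a_{d+1}$ satisfying, after relabelling vertices, $$a_1 = \dots = a_m, \qquad a_{m+1} = \dots = a_{d+1}.$$ This happens for any given value of $m\ge 2$ if $d$ is large enough; in particular it happens when $m = 2$ and $d \ge 9$.
   Context: A $d$-simplex in $\mathbb{E}^d$ is the convex hull of $d+1$ affinely independent points $A_1,\dots,A_{d+1}$. It is orthocentric if its altitudes (lines through each vertex perpendicular to the hyperplane of the opposite facet) have a common point, the orthocenter $H$; it is rectangular if $H$ is one of its vertices. The barycentric coordinates of $H$ are the unique reals with $H=\sum a_iA_i$, $\sum a_i=1$. A simplex is regular if all edges have the same length, and equiradial if all its facets ($(d-1)$-faces) have equal circumradii. *)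

theory Defs
  imports "HOL-Analysis.Analysis"
begin

text \<open>
  Euclidean \<open>d\<close>-space is a type \<open>'a :: euclidean_space\<close> with \<open>DIM('a) = d\<close>, and a
  \<open>d\<close>-simplex is a set \<open>S\<close> with \<open>int d simplex S\<close> in the sense of HOL-Analysis.
\<close>

definition vertices :: "'a::euclidean_space set \<Rightarrow> 'a set" where
  "vertices S = {A. A extreme_point_of S}"

text \<open>
  The hyperplane of the facet opposite to \<open>A\<close> is the affine hull of the other vertices.
  For a full-dimensional simplex the set below is a line, since the directions of that
  hyperplane span a subspace of codimension one.
\<close>

definition altitude :: "'a::euclidean_space set \<Rightarrow> 'a \<Rightarrow> 'a set" where
  "altitude S A =
     {P. \<forall>X \<in> affine hull (vertices S - {A}). \<forall>Y \<in> affine hull (vertices S - {A}).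
           (P - A) \<bullet> (X - Y) = 0}"

definition is_orthocenter :: "'a::euclidean_space \<Rightarrow> 'a set \<Rightarrow> bool" where
  "is_orthocenter H S \<longleftrightarrow> (\<forall>A \<in> vertices S. H \<in> altitude S A)"

definition orthocentric :: "'a::euclidean_space set \<Rightarrow> bool" where
  "orthocentric S \<longleftrightarrow> (\<exists>H. is_orthocenter H S)"

definition rectangular :: "'a::euclidean_space set \<Rightarrow> bool" where
  "rectangular S \<longleftrightarrow> (\<exists>H \<in> vertices S. is_orthocenter H S)"

definition regular_simplex :: "'a::euclidean_space set \<Rightarrow> bool" where
  "regular_simplex S \<longleftrightarrow>
     (\<exists>l. \<forall>A \<in> vertices S. \<forall>B \<in> vertices S. A \<noteq> B \<longrightarrow> dist A B = l)"

text \<open>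
  The circumcenter is sought in the affine hull of \<open>S\<close>, so that the definition applies to a
  facet, which is a simplex of lower dimension than the ambient space. For every simplex the
  circumcenter, hence the radius, exists and is unique.
\<close>

definition circumradius :: "'a::euclidean_space set \<Rightarrow> real" where
  "circumradius S = (THE r. \<exists>C \<in> affine hull S. \<forall>A \<in> vertices S. dist C A = r)"

definition equiradial :: "'a::euclidean_space set \<Rightarrow> bool" where
  "equiradial S \<longleftrightarrow>
     (\<forall>F G. F facet_of S \<longrightarrow> G facet_of S \<longrightarrow> circumradius F = circumradius G)"

text \<open>
  Some labelling \<open>A 1, \<dots>, A (d+1)\<close> of the vertices makes the first \<open>m\<close> barycentric
  coordinates of the orthocenter equal, and the remaining ones equal.
\<close>

definition orthocenter_two_blocks :: "nat \<Rightarrow> nat \<Rightarrow> 'a::euclidean_space set \<Rightarrow> bool" where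
  "orthocenter_two_blocks d m S \<longleftrightarrow>
     (\<exists>H A a. is_orthocenter H S \<and>
        bij_betw A {1..d+1} (vertices S) \<and>
        (\<Sum>i=1..d+1. a i) = (1::real) \<and>
        (\<Sum>i=1..d+1. a i *\<^sub>R A i) = H \<and>
        (\<forall>i\<in>{1..m}. \<forall>j\<in>{1..m}. a i = a j) \<and>
        (\<forall>i\<in>{m+1..d+1}. \<forall>j\<in>{m+1..d+1}. a i = a j))"

definition similar_sets :: "'a::euclidean_space set \<Rightarrow> 'a set \<Rightarrow> bool" where
  "similar_sets S T \<longleftrightarrow>
     (\<exists>f c. c > 0 \<and> (\<forall>x y. dist (f x) (f y) = c * dist x y) \<and> f ` S = T)"

definition exactly_two_up_to_similarity :: "('a::euclidean_space set \<Rightarrow> bool) \<Rightarrow> bool" where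
  "exactly_two_up_to_similarity P \<longleftrightarrow>
     (\<exists>S T. P S \<and> P T \<and> \<not> similar_sets S T \<and>
        (\<forall>U. P U \<longrightarrow> similar_sets U S \<or> similar_sets U T))"

definition special_simplex :: "nat \<Rightarrow> nat \<Rightarrow> 'a::euclidean_space set \<Rightarrow> bool" where
  "special_simplex d m S \<longleftrightarrow>
     int d simplex S \<and> \<not> regular_simplex S \<and> \<not> rectangular S \<and>
     orthocentric S \<and> equiradial S \<and> orthocenter_two_blocks d m S"

definition admissible :: "nat \<Rightarrow> nat \<Rightarrow> bool" where
  "admissible d m \<longleftrightarrow> d > 3 \<and> 2 \<le> m \<and> m \<le> d - 1 \<and>
     real m * (real d + 1 - real m)
       \<le> (((real d)\<^sup>2 - 3 * real d + 4) / (2 * (real d - 2)))\<^sup>2"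

end

theory Submission
  imports Defs
begin

text \<open>
  A simplex is described by positive weights \<open>x i\<close> of its vertices if the squared length of the edge
  from \<open>A i\<close> to \<open>A j\<close> is \<open>x i + x j\<close>. Such a simplex is orthocentric, and the barycentric coordinates of its
  orthocenter are inversely proportional to the weights (\<open>orthocenter\<close>). Conversely, the edge lengths
  of a non-rectangular orthocentric simplex have this form with weights inversely proportional to the
  coordinates of the orthocenter (\<open>orthocenter_edge_lengths\<close>). If these coordinates form two blocks of
  equal values, of sizes \<open>m \<ge> 2\<close> and \<open>n = d + 1 - m \<ge> 2\<close>, then the weights take two values, both
  positive, and the simplex is determined up to similarity by their ratio \<open>r\<close>
  (\<open>proportional_imp_similar\<close>); every positive \<open>r\<close> occurs (\<open>weighted_simplex_exists\<close>).

  With the weights, a facet has a closed formula for its circumradius (\<open>circumradius_sq\<close>). Facets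
  opposite to vertices of different weight have equal radii if and only if
  \<open>(S * x i - 1) * (S * x j - 1) = (d - 2)\<^sup>2\<close>, where \<open>S\<close> is the sum of the reciprocal weights
  (\<open>equiradial_iff\<close>). For two blocks this is a quadratic equation for \<open>r\<close>:
  \<open>n * (n - 1) * r\<^sup>2 - (d\<^sup>2 - 3 * d + 4 - 2 * m * n) * r + m * (m - 1) = 0\<close>.
  The regular simplex, \<open>r = 1\<close>, is never a root. The discriminant is nonnegative if and only if the
  bound on \<open>m * n\<close> holds. The bound is never attained by integers, and under it both roots are positive
  (\<open>admissible_strict\<close>, \<open>admissible_roots\<close>). So there are two simplices. They are not similar, because
  the bound excludes \<open>m = n\<close> (\<open>admissible_unbalanced\<close>) and a similarity must then respect the blocks
  (\<open>similar_block_simplices_ratio_eq\<close>).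
\<close>

section \<open>Simplices whose squared edge lengths are sums of vertex weights\<close>

text \<open>
  The model is the simplex with vertices \<open>sqrt (x i)\<close> times the \<open>i\<close>-th unit vector, which has
  these edge lengths but lives in one dimension too many. Fixing only the edge lengths keeps
  the vertices inside the given space, and lets the same facts apply to a simplex and to its facets.
\<close>

locale weighted_simplex =
  fixes I :: "'i set" and x :: "'i \<Rightarrow> real" and A :: "'i \<Rightarrow> 'a::euclidean_space"
  assumes finite_I: "finite I"
    and pos: "\<And>i. i \<in> I \<Longrightarrow> 0 < x i"
    and dist_sq: "\<And>i j. i \<in> I \<Longrightarrow> j \<in> I \<Longrightarrow> i \<noteq> j \<Longrightarrow> (dist (A i) (A j))\<^sup>2 = x i + x j"
begin

lemma subfamily: "J \<subseteq> I \<Longrightarrow> weighted_simplex J x A"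
  using finite_I pos dist_sq by unfold_locales (simp_all add: finite_subset subset_iff)

lemma inner_vertices:
  assumes "i \<in> I" "j \<in> I" "i \<noteq> j"
  shows "A i \<bullet> A j = ((A i \<bullet> A i) + (A j \<bullet> A j) - (x i + x j)) / 2"
proof -
  have "x i + x j = (A i \<bullet> A i) + (A j \<bullet> A j) - 2 * (A i \<bullet> A j)"
    unfolding dist_sq[OF assms, symmetric]
    by (simp add: dist_norm power2_norm_eq_inner inner_diff_left inner_diff_right inner_commute)
  then show ?thesis by (simp add: field_simps)
qed

text \<open>
  On the directions of the affine hull the inner product is diagonal: the edge lengths give
  \<open>A i \<bullet> A j = g i + g j + (if i = j then x i else 0)\<close> with \<open>g i = (A i \<bullet> A i - x i) / 2\<close>, and the
  terms \<open>g i + g j\<close> cancel against coefficients with sum \<open>0\<close>. This yields affine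
  independence and the distances from affine combinations to the vertices.
\<close>

lemma inner_zero_sum:
  assumes u: "sum u I = 0" and v: "sum v I = 0"
  shows "(\<Sum>i\<in>I. u i *\<^sub>R A i) \<bullet> (\<Sum>i\<in>I. v i *\<^sub>R A i) = (\<Sum>i\<in>I. u i * v i * x i)"
proof -
  define g where "g i = ((A i \<bullet> A i) - x i) / 2" for i
  have "(\<Sum>i\<in>I. u i *\<^sub>R A i) \<bullet> (\<Sum>i\<in>I. v i *\<^sub>R A i) = (\<Sum>i\<in>I. \<Sum>j\<in>I. u i * v j * (A i \<bullet> A j))"
    unfolding inner_sum_left by (intro sum.cong refl) (simp add: inner_sum_right sum_distrib_left mult_ac)
  also have "\<dots> = (\<Sum>i\<in>I. \<Sum>j\<in>I. u i * g i * v j + u i * (g j * v j)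
                    + (if j = i then u i * v i * x i else 0))"
  proof (intro sum.cong refl)
    fix i j assume "i \<in> I" "j \<in> I"
    then have "A i \<bullet> A j = g i + g j + (if i = j then x i else 0)"
      by (cases "i = j") (simp_all add: inner_vertices g_def field_simps)
    then show "u i * v j * (A i \<bullet> A j) =
        u i * g i * v j + u i * (g j * v j) + (if j = i then u i * v i * x i else 0)"
      by (simp add: algebra_simps)
  qed
  also have "\<dots> = (\<Sum>i\<in>I. u i * g i) * sum v I + sum u I * (\<Sum>j\<in>I. g j * v j)
                    + (\<Sum>i\<in>I. u i * v i * x i)"
    using finite_I by (simp add: sum.distrib sum_product)
  finally show ?thesis using u v by simp
qed

lemma zero_sum_eq_0:
  assumes "sum u I = 0" "(\<Sum>i\<in>I. u i *\<^sub>R A i) = 0" "i \<in> I"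
  shows "u i = 0"
proof -
  have "(\<Sum>i\<in>I. u i * u i * x i) = 0"
    using inner_zero_sum[OF assms(1,1)] assms(2) by simp
  moreover have "\<forall>i\<in>I. 0 \<le> u i * u i * x i"
    using pos by (metis less_imp_le mult_nonneg_nonneg zero_le_square)
  ultimately have "u i * u i * x i = 0"
    using finite_I assms(3) by (simp add: sum_nonneg_eq_0_iff)
  then show ?thesis using pos[OF assms(3)] by simp
qed

lemma inj: "inj_on A I"
proof (rule inj_onI)
  fix i j assume "i \<in> I" "j \<in> I" "A i = A j"
  then show "i = j" using dist_sq[of i j] pos[of i] pos[of j] by (cases "i = j") simp_all
qed

lemma affine_independent: "\<not> affine_dependent (A ` I)"
proof
  assume "affine_dependent (A ` I)"
  then obtain U i where U: "sum U (A ` I) = 0" "(\<Sum>v\<in>A ` I. U v *\<^sub>R v) = 0"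
      and i: "i \<in> I" "U (A i) \<noteq> 0"
    using finite_I by (auto simp: affine_dependent_explicit_finite)
  have "(\<Sum>i\<in>I. U (A i)) = 0" "(\<Sum>i\<in>I. U (A i) *\<^sub>R A i) = 0"
    using U by (simp_all add: sum.reindex[OF inj])
  from zero_sum_eq_0[OF this i(1)] show False using i(2) by simp
qed

lemma vertices_eq: "vertices (convex hull (A ` I)) = A ` I"
  by (simp add: vertices_def extreme_point_of_convex_hull_affine_independent[OF affine_independent])

lemma is_simplex: "card I = n + 1 \<Longrightarrow> int n simplex (convex hull (A ` I))"
  by (rule simplex_convex_hull) (simp add: affine_independent card_image[OF inj])

lemma affine_hull_eq:
  "affine hull (convex hull (A ` I)) = {\<Sum>i\<in>I. c i *\<^sub>R A i |c. sum c I = 1}"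
proof -
  have "\<exists>c. sum c I = 1 \<and> (\<Sum>i\<in>I. U (A i) *\<^sub>R A i) = (\<Sum>i\<in>I. c i *\<^sub>R A i)"
    if "(\<Sum>i\<in>I. U (A i)) = 1" for U using that by auto
  moreover have "\<exists>U. (\<Sum>i\<in>I. U (A i)) = 1 \<and> (\<Sum>i\<in>I. U (A i) *\<^sub>R A i) = (\<Sum>i\<in>I. c i *\<^sub>R A i)"
    if "sum c I = 1" for c
    using that by (intro exI[of _ "c \<circ> inv_into I A"]) (simp add: inv_into_f_f[OF inj])
  ultimately show ?thesis
    using finite_I by (auto simp: affine_hull_finite sum.reindex[OF inj] affine_hull_convex_hull)
qed

text \<open>
  The inner product at a vertex recovers the weight of that vertex, whatever two other vertices
  are used; so the weights are determined by the simplex.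
\<close>

lemma corner:
  assumes "i \<in> I" "j \<in> I" "k \<in> I" "i \<noteq> j" "i \<noteq> k" "j \<noteq> k"
  shows "(A j - A i) \<bullet> (A k - A i) = x i"
  using assms by (simp add: inner_diff_left inner_diff_right inner_vertices field_simps)

text \<open>
  The diagonal form applied to the coefficients of \<open>c\<close> minus the \<open>k\<close>-th unit coefficient.
\<close>

lemma dist_sq_combination:
  assumes c: "sum c I = 1" and k: "k \<in> I"
  shows "(dist (\<Sum>i\<in>I. c i *\<^sub>R A i) (A k))\<^sup>2 = (\<Sum>i\<in>I. (c i)\<^sup>2 * x i) - 2 * c k * x k + x k"
proof -
  define u where "u i = c i - (if i = k then 1 else 0)" for i
  have u0: "sum u I = 0" using c k finite_I by (simp add: u_def sum_subtractf)
  have "(\<Sum>i\<in>I. u i *\<^sub>R A i) = (\<Sum>i\<in>I. c i *\<^sub>R A i - (if i = k then A i else 0))"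
    by (intro sum.cong refl) (auto simp: u_def algebra_simps)
  also have "\<dots> = (\<Sum>i\<in>I. c i *\<^sub>R A i) - A k"
    using k finite_I by (simp add: sum_subtractf)
  finally have "(dist (\<Sum>i\<in>I. c i *\<^sub>R A i) (A k))\<^sup>2 = (\<Sum>i\<in>I. u i * u i * x i)"
    using inner_zero_sum[OF u0 u0] by (simp add: dist_norm power2_norm_eq_inner)
  also have "\<dots> = (\<Sum>i\<in>I. (c i)\<^sup>2 * x i + (if i = k then x i - 2 * c i * x i else 0))"
    by (intro sum.cong refl) (auto simp: u_def algebra_simps power2_eq_square)
  also have "\<dots> = (\<Sum>i\<in>I. (c i)\<^sup>2 * x i) - 2 * c k * x k + x k"
    using k finite_I by (simp add: sum.distrib)
  finally show ?thesis .
qed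

section \<open>Circumradii\<close>

lemma sum_inverse_pos: "I \<noteq> {} \<Longrightarrow> 0 < (\<Sum>i\<in>I. 1 / x i)"
  using finite_I pos by (intro sum_pos) auto

text \<open>
  The squared distance to \<open>A k\<close> depends on \<open>k\<close> only through \<open>x k - 2 * c k * x k\<close>. Making this
  the same for all \<open>k\<close> means \<open>c k = 1 / 2 + t / x k\<close> for one number \<open>t\<close>, and the condition that
  the \<open>c k\<close> sum to \<open>1\<close> fixes \<open>t\<close>. This gives existence and uniqueness of the circumcenter
  together with the radius.
\<close>

lemma equidistant_iff:
  assumes ne: "I \<noteq> {}" and c: "sum c I = 1" and r: "0 \<le> r"
  defines "S \<equiv> \<Sum>i\<in>I. 1 / x i"
  defines "t \<equiv> (2 - real (card I)) / (2 * S)"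
  shows "(\<forall>k\<in>I. dist (\<Sum>i\<in>I. c i *\<^sub>R A i) (A k) = r) \<longleftrightarrow>
    (\<forall>k\<in>I. c k = 1 / 2 + t / x k) \<and> r\<^sup>2 = ((\<Sum>i\<in>I. x i) - (real (card I) - 2)\<^sup>2 / S) / 4"
    (is "?L \<longleftrightarrow> ?R1 \<and> ?R2")
proof -
  have S: "0 < S" unfolding S_def by (rule sum_inverse_pos[OF ne])
  have sum_c: "(\<Sum>k\<in>I. 1 / 2 + z / x k) = card I / 2 + z * S" for z
    by (simp add: sum.distrib S_def sum_distrib_left)
  let ?Q = "\<Sum>i\<in>I. (c i)\<^sup>2 * x i"
  have Q: "?Q = (\<Sum>i\<in>I. x i) / 4 + card I * t + t\<^sup>2 * S" if ?R1
  proof -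
    have "?Q = (\<Sum>i\<in>I. x i / 4 + t + t\<^sup>2 * (1 / x i))"
    proof (intro sum.cong refl)
      fix i assume i: "i \<in> I"
      then have ci: "c i = 1 / 2 + t / x i" using that by blast
      show "(c i)\<^sup>2 * x i = x i / 4 + t + t\<^sup>2 * (1 / x i)"
        unfolding ci using pos[OF i] by (simp add: power2_eq_square field_simps)
    qed
    then show ?thesis
      by (simp only: sum.distrib sum_distrib_left[symmetric] sum_divide_distrib[symmetric]
          sum_constant S_def)
  qed
  have R: "?Q - 2 * t = ((\<Sum>i\<in>I. x i) - (real (card I) - 2)\<^sup>2 / S) / 4" if ?R1
  proof -
    have "?Q - 2 * t = (\<Sum>i\<in>I. x i) / 4 + (real (card I) - 2) * t + t\<^sup>2 * S"
      using Q[OF that] by (simp add: algebra_simps)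
    also have "\<dots> = (\<Sum>i\<in>I. x i) / 4 - (real (card I) - 2)\<^sup>2 / S / 4"
      using S by (simp add: t_def field_simps power2_eq_square)
    finally show ?thesis by simp
  qed
  have D: "(dist (\<Sum>i\<in>I. c i *\<^sub>R A i) (A k))\<^sup>2 = ?Q - 2 * c k * x k + x k" if "k \<in> I" for k
    by (rule dist_sq_combination[OF c that])
  have D1: "(dist (\<Sum>i\<in>I. c i *\<^sub>R A i) (A k))\<^sup>2 = ?Q - 2 * t" if "k \<in> I" ?R1 for k
  proof -
    have ck: "c k = 1 / 2 + t / x k" using that by blast
    show ?thesis
      unfolding D[OF that(1)] using pos[OF that(1)] by (simp add: ck algebra_simps)
  qed
  show ?thesis
  proof
    assume L: ?L
    define q where "q = (?Q - r\<^sup>2) / 2"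
    have "c k = 1 / 2 + q / x k" if "k \<in> I" for k
      using D[OF that] L pos[OF that] that by (simp add: q_def field_simps)
    then have c_eq: "\<forall>k\<in>I. c k = 1 / 2 + q / x k" by blast
    then have "card I / 2 + q * S = 1"
      using c sum_c[of q] by simp
    then have "q = t"
      using S by (simp add: t_def field_simps)
    then have R1: ?R1 using c_eq by blast
    obtain k where "k \<in> I" using ne by blast
    then have "r\<^sup>2 = ?Q - 2 * t" using D1[OF _ R1] L by auto
    then show "?R1 \<and> ?R2" using R[OF R1] R1 by simp
  next
    assume R12: "?R1 \<and> ?R2"
    show ?L
    proof
      fix k assume "k \<in> I"
      from D1[OF this] R R12 have "(dist (\<Sum>i\<in>I. c i *\<^sub>R A i) (A k))\<^sup>2 = r\<^sup>2"
        by presburger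
      then show "dist (\<Sum>i\<in>I. c i *\<^sub>R A i) (A k) = r"
        using r by (simp add: power2_eq_iff_nonneg)
    qed
  qed
qed

lemma circumradius_sq:
  assumes ne: "I \<noteq> {}"
  shows "0 \<le> circumradius (convex hull (A ` I))"
    and "(circumradius (convex hull (A ` I)))\<^sup>2 =
           ((\<Sum>i\<in>I. x i) - (real (card I) - 2)\<^sup>2 / (\<Sum>i\<in>I. 1 / x i)) / 4"
proof -
  let ?S = "\<Sum>i\<in>I. 1 / x i" and ?P = "\<lambda>c. \<Sum>i\<in>I. c i *\<^sub>R A i"
  let ?R = "((\<Sum>i\<in>I. x i) - (real (card I) - 2)\<^sup>2 / ?S) / 4"
  define t where "t = (2 - real (card I)) / (2 * ?S)"
  define c where "c k = 1 / 2 + t / x k" for k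
  have S: "0 < ?S" by (rule sum_inverse_pos[OF ne])
  have c1: "sum c I = 1"
  proof -
    have "sum c I = card I / 2 + t * ?S"
      by (simp add: c_def sum.distrib sum_distrib_left)
    then show ?thesis using S by (simp add: t_def field_simps)
  qed
  obtain k where k: "k \<in> I" using ne by blast
  let ?r = "dist (?P c) (A k)"
  have eqd: "\<forall>j\<in>I. dist (?P c) (A j) = ?r"
  proof
    fix j assume j: "j \<in> I"
    have "(dist (?P c) (A j))\<^sup>2 = ?r\<^sup>2"
      unfolding dist_sq_combination[OF c1 j] dist_sq_combination[OF c1 k]
      using pos[OF j] pos[OF k] by (simp add: c_def field_simps)
    then show "dist (?P c) (A j) = ?r" by simp
  qed
  have "circumradius (convex hull (A ` I)) = ?r"
    unfolding circumradius_def vertices_eq affine_hull_eq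
  proof (rule the_equality)
    show "\<exists>C\<in>{?P c |c. sum c I = 1}. \<forall>B\<in>A ` I. dist C B = ?r"
      using c1 eqd by blast
  next
    fix r assume "\<exists>C\<in>{?P c |c. sum c I = 1}. \<forall>B\<in>A ` I. dist C B = r"
    then obtain c' where c': "sum c' I = 1" "\<forall>j\<in>I. dist (?P c') (A j) = r" by blast
    then have r0: "0 \<le> r" using k by (metis zero_le_dist)
    have "r\<^sup>2 = ?R" using equidistant_iff[OF ne c'(1) r0] c'(2) by blast
    moreover have "?r\<^sup>2 = ?R" using equidistant_iff[OF ne c1 zero_le_dist] eqd by blast
    ultimately show "r = ?r" using r0 by (metis power2_eq_iff_nonneg zero_le_dist)
  qed
  moreover have "?r\<^sup>2 = ?R" using equidistant_iff[OF ne c1 zero_le_dist] eqd by blast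
  ultimately show "0 \<le> circumradius (convex hull (A ` I))"
    "(circumradius (convex hull (A ` I)))\<^sup>2 = ?R" by simp_all
qed

lemma facet_iff:
  assumes "2 \<le> card I"
  shows "F facet_of convex hull (A ` I) \<longleftrightarrow> (\<exists>k\<in>I. F = convex hull (A ` (I - {k})))"
proof -
  have "A ` I - {A k} = A ` (I - {k})" if "k \<in> I" for k
    using inj_on_image_set_diff[OF inj, of I "{k}"] that by auto
  then show ?thesis
    using assms by (auto simp: facet_of_convex_hull_affine_independent_alt[OF affine_independent]
        card_image[OF inj])
qed

text \<open>
  Let \<open>X\<close> be the sum of the weights, \<open>N\<close> the number of vertices, \<open>K = (N - 3)\<^sup>2\<close> and
  \<open>p i = S * x i - 1\<close>. Four times the squared radius of the facet opposite to \<open>A i\<close> is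
  \<open>X - (x i + K * x i / p i)\<close>. For two facets, clearing denominators in the equality of these values
  leaves \<open>(x i - x j) * (p i * p j - K) = 0\<close>, because \<open>x i * p j - x j * p i = x j - x i\<close>.
\<close>

lemma equiradial_iff:
  assumes card: "2 \<le> card I"
  defines "S \<equiv> \<Sum>i\<in>I. 1 / x i"
  shows "equiradial (convex hull (A ` I)) \<longleftrightarrow>
    (\<forall>i\<in>I. \<forall>j\<in>I. x i \<noteq> x j \<longrightarrow> (S * x i - 1) * (S * x j - 1) = (real (card I) - 3)\<^sup>2)"
proof -
  define K where "K = (real (card I) - 3)\<^sup>2"
  have facet: "weighted_simplex (I - {k}) x A" "I - {k} \<noteq> {}"
      "(\<Sum>i\<in>I - {k}. x i) = (\<Sum>i\<in>I. x i) - x k" "(\<Sum>i\<in>I - {k}. 1 / x i) = S - 1 / x k"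
      "real (card (I - {k})) - 2 = real (card I) - 3"
    if k: "k \<in> I" for k
  proof -
    show "weighted_simplex (I - {k}) x A" by (rule subfamily) auto
    have "card (I - {k}) = card I - 1" using k by simp
    then show "I - {k} \<noteq> {}" "real (card (I - {k})) - 2 = real (card I) - 3"
      using card by (fastforce, simp)
  qed (use finite_I k in \<open>simp_all add: sum_diff1 S_def\<close>)
  define R where "R k = circumradius (convex hull (A ` (I - {k})))" for k
  have R: "0 \<le> R k" "(R k)\<^sup>2 = ((\<Sum>i\<in>I. x i) - x k - K / (S - 1 / x k)) / 4" if "k \<in> I" for k
    using weighted_simplex.circumradius_sq[OF facet(1,2)[OF that]] facet(3-5)[OF that]
    by (simp_all add: R_def K_def)
  have Spos: "0 < S * x k - 1" if "k \<in> I" for k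
    using weighted_simplex.sum_inverse_pos[OF facet(1,2)[OF that]] facet(4)[OF that] pos[OF that]
    by (simp add: field_simps)
  have "R i = R j \<longleftrightarrow> (x i \<noteq> x j \<longrightarrow> (S * x i - 1) * (S * x j - 1) = K)"
    if ij: "i \<in> I" "j \<in> I" for i j
  proof -
    let ?p = "S * x i - 1" and ?q = "S * x j - 1"
    have xi: "0 < x i" "0 < x j" and pq: "0 < ?p" "0 < ?q"
      using pos ij Spos by auto
    have quot: "K / (S - 1 / x i) = K * x i / ?p" "K / (S - 1 / x j) = K * x j / ?q"
      using xi pq by (simp_all add: field_simps)
    have "R i = R j \<longleftrightarrow> (R i)\<^sup>2 = (R j)\<^sup>2" using R(1)[OF ij(1)] R(1)[OF ij(2)] by simp
    also have "\<dots> \<longleftrightarrow> x i + K * x i / ?p = x j + K * x j / ?q"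
      using R(2)[OF ij(1)] R(2)[OF ij(2)] quot by auto
    also have "\<dots> \<longleftrightarrow> (x i + K * x i / ?p) * (?p * ?q) = (x j + K * x j / ?q) * (?p * ?q)"
      using pq by simp
    also have "\<dots> \<longleftrightarrow> x i * ?p * ?q + K * x i * ?q = x j * ?p * ?q + K * x j * ?p"
      using pq by (simp add: distrib_right mult.assoc)
    also have "\<dots> \<longleftrightarrow> (x i - x j) * (?p * ?q - K) = 0"
      by (simp add: algebra_simps)
    finally show ?thesis by auto
  qed
  moreover have "equiradial (convex hull (A ` I)) \<longleftrightarrow> (\<forall>i\<in>I. \<forall>j\<in>I. R i = R j)"
    by (auto simp: equiradial_def facet_iff[OF card] R_def)
  ultimately show ?thesis by (simp add: K_def)
qed

section \<open>The orthocenter\<close>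

lemma orthocenter_coordinates_sum:
  assumes "I \<noteq> {}"
  shows "(\<Sum>i\<in>I. 1 / ((\<Sum>j\<in>I. 1 / x j) * x i)) = 1"
proof -
  have "(\<Sum>i\<in>I. 1 / (S * x i)) = (\<Sum>i\<in>I. 1 / x i) / S" for S
    by (simp add: sum_divide_distrib mult.commute)
  then show ?thesis using sum_inverse_pos[OF assms] by simp
qed

text \<open>
  For \<open>H\<close> with barycentric coordinates \<open>h i\<close>, the diagonal form gives
  \<open>(H - A k) \<bullet> (A i - A j) = h i * x i - h j * x j\<close> for \<open>i\<close> and \<open>j\<close> different from \<open>k\<close>. So the orthocenter
  has coordinates inversely proportional to the weights.
\<close>

lemma orthocenter:
  assumes ne: "I \<noteq> {}"
  defines "S \<equiv> \<Sum>i\<in>I. 1 / x i"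
  shows "is_orthocenter (\<Sum>i\<in>I. (1 / (S * x i)) *\<^sub>R A i) (convex hull (A ` I))"
proof -
  let ?h = "\<lambda>i. 1 / (S * x i)"
  let ?H = "\<Sum>i\<in>I. ?h i *\<^sub>R A i"
  have S: "0 < S" unfolding S_def by (rule sum_inverse_pos[OF ne])
  have h1: "sum ?h I = 1" unfolding S_def by (rule orthocenter_coordinates_sum[OF ne])
  have perp: "(?H - A k) \<bullet> (A i - A j) = 0"
    if "k \<in> I" "i \<in> I" "j \<in> I" "i \<noteq> k" "j \<noteq> k" for i j k
  proof -
    have d: "(dist ?H (A l))\<^sup>2 = (\<Sum>i\<in>I. (?h i)\<^sup>2 * x i) - 2 / S + x l" if "l \<in> I" for l
      using dist_sq_combination[OF h1 that] pos[OF that] by simp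
    \<comment> \<open>Polarisation expresses the inner product by four squared distances, all known.\<close>
    have "2 * ((?H - A k) \<bullet> (A i - A j)) =
        (dist ?H (A j))\<^sup>2 - (dist ?H (A i))\<^sup>2 + (dist (A k) (A i))\<^sup>2 - (dist (A k) (A j))\<^sup>2"
      by (simp add: dist_norm power2_norm_eq_inner inner_diff_left inner_diff_right inner_commute)
    also have "\<dots> = 0" using that d dist_sq by simp
    finally show ?thesis by simp
  qed
  show ?thesis
    unfolding is_orthocenter_def vertices_eq
  proof clarify
    fix k assume k: "k \<in> I"
    let ?V = "A ` I - {A k}"
    have "(?H - A k) \<bullet> (X - Y) = 0" if X: "X \<in> affine hull ?V" and Y: "Y \<in> affine hull ?V" for X Y
    proof -
      obtain j where j: "j \<in> I" "j \<noteq> k" using X by (cases "?V = {}") auto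
      have "affine hull ?V \<subseteq> {X. (?H - A k) \<bullet> X = (?H - A k) \<bullet> A j}"
      proof (rule hull_minimal)
        show "?V \<subseteq> {X. (?H - A k) \<bullet> X = (?H - A k) \<bullet> A j}"
        proof clarify
          fix i assume "i \<in> I" "A i \<notin> {}" "A i \<noteq> A k"
          then show "(?H - A k) \<bullet> A i = (?H - A k) \<bullet> A j"
            using perp[OF k _ j(1) _ j(2), of i] by (auto simp: inner_diff_right)
        qed
      qed (rule affine_hyperplane)
      then have "(?H - A k) \<bullet> X = (?H - A k) \<bullet> A j" "(?H - A k) \<bullet> Y = (?H - A k) \<bullet> A j"
        using X Y by blast+
      then show ?thesis by (simp add: inner_diff_right)
    qed
    then show "?H \<in> altitude (convex hull (A ` I)) (A k)"
      by (simp add: altitude_def vertices_eq)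
  qed
qed

text \<open>
  If the vertex \<open>A k\<close> were the orthocenter, two edges at \<open>A k\<close> would be perpendicular, but their
  inner product is the positive number \<open>x k\<close>.
\<close>

lemma not_rectangular:
  assumes card: "3 \<le> card I"
  shows "\<not> rectangular (convex hull (A ` I))"
proof
  assume "rectangular (convex hull (A ` I))"
  then obtain k where k: "k \<in> I" and o: "is_orthocenter (A k) (convex hull (A ` I))"
    by (auto simp: rectangular_def vertices_eq)
  have "2 \<le> card (I - {k})" using card k by simp
  then obtain i j where ij: "i \<in> I" "j \<in> I" "i \<noteq> k" "j \<noteq> k" "i \<noteq> j"
    by (auto simp: card_le_Suc_iff numeral_2_eq_2)
  have "A k \<in> affine hull (A ` I - {A i})" "A j \<in> affine hull (A ` I - {A i})"
    using ij k inj by (auto intro!: hull_inc dest: inj_onD)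
  then have "(A k - A i) \<bullet> (A k - A j) = 0"
    using o ij by (auto simp: is_orthocenter_def vertices_eq altitude_def)
  then have "(A i - A k) \<bullet> (A j - A k) = 0"
    by (simp add: inner_diff_left inner_diff_right inner_commute algebra_simps)
  then show False using corner[OF k ij(1,2)] ij pos[OF k] by simp
qed

end

section \<open>Similarities\<close>

lemma similarity_affine:
  fixes f :: "'a::euclidean_space \<Rightarrow> 'a"
  assumes c: "0 < c" and f: "\<forall>u v. dist (f u) (f v) = c * dist u v"
  obtains h where "linear h" and "f = (\<lambda>u. f 0 + h u)"
proof -
  define g where "g u = (f u - f 0) /\<^sub>R c" for u
  have "dist (g u) (g v) = dist u v" for u v
  proof -
    have "dist (g u) (g v) = norm (f u - f v) / c"
      using c by (simp add: g_def dist_norm divide_inverse_commute flip: scaleR_diff_right)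
    also have "\<dots> = dist u v" using f c by (simp add: dist_norm)
    finally show ?thesis .
  qed
  then have "orthogonal_transformation g"
    by (simp add: orthogonal_transformation_isometry g_def)
  then have "linear (\<lambda>u. c *\<^sub>R g u)"
    by (intro linear_compose_scale_right orthogonal_transformation_linear)
  moreover have "f = (\<lambda>u. f 0 + c *\<^sub>R g u)"
    using c by (simp add: g_def)
  ultimately show ?thesis by (rule that)
qed

lemma similarity_convex_hull:
  fixes f :: "'a::euclidean_space \<Rightarrow> 'a"
  assumes c: "0 < c" and f: "\<forall>u v. dist (f u) (f v) = c * dist u v"
  shows "f ` (convex hull V) = convex hull (f ` V)"
proof -
  obtain h where h: "linear h" and fh: "f = (\<lambda>u. f 0 + h u)"
    using similarity_affine[OF assms] .
  have im: "f ` W = (\<lambda>u. f 0 + u) ` h ` W" for W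
    by (subst fh) auto
  show ?thesis
    unfolding im by (simp add: convex_hull_translation convex_hull_linear_image[OF h])
qed

text \<open>
  A similarity maps vertices to vertices, which gives the permutation, and it scales the inner
  product at each vertex, that is its weight, by the square of its ratio.
\<close>

lemma similar_imp_proportional:
  fixes A B :: "'i \<Rightarrow> 'a::euclidean_space"
  assumes A: "weighted_simplex I x A" and B: "weighted_simplex I y B"
    and card: "3 \<le> card I"
    and sim: "similar_sets (convex hull (A ` I)) (convex hull (B ` I))"
  obtains c p where "0 < c" and "bij_betw p I I" and "\<And>i. i \<in> I \<Longrightarrow> y (p i) = c * x i"
proof -
  interpret A: weighted_simplex I x A by (rule A)
  interpret B: weighted_simplex I y B by (rule B)
  obtain f c where c: "0 < c" and f: "\<forall>u v. dist (f u) (f v) = c * dist u v"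
    and img: "f ` (convex hull (A ` I)) = convex hull (B ` I)"
    using sim unfolding similar_sets_def by blast
  interpret F: weighted_simplex I "\<lambda>i. c\<^sup>2 * x i" "f \<circ> A"
  proof
    fix i j assume "i \<in> I" "j \<in> I" "i \<noteq> j"
    then show "(dist ((f \<circ> A) i) ((f \<circ> A) j))\<^sup>2 = c\<^sup>2 * x i + c\<^sup>2 * x j"
      using f by (simp add: A.dist_sq power_mult_distrib distrib_left)
  qed (use A.finite_I A.pos c in auto)
  have "convex hull ((f \<circ> A) ` I) = convex hull (B ` I)"
    using img unfolding similarity_convex_hull[OF c f] image_comp .
  then have verts: "(f \<circ> A) ` I = B ` I"
    by (metis F.vertices_eq B.vertices_eq)
  define p where "p = inv_into I B \<circ> (f \<circ> A)"
  have p: "bij_betw p I I"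
    unfolding p_def
  proof (rule bij_betw_trans)
    show "bij_betw (f \<circ> A) I (B ` I)" using F.inj verts by (simp add: bij_betw_def)
    show "bij_betw (inv_into I B) (B ` I) I"
      by (rule bij_betw_inv_into) (simp add: bij_betw_def B.inj)
  qed
  have Bp: "B (p i) = (f \<circ> A) i" if "i \<in> I" for i
    using verts that unfolding p_def comp_apply[of "inv_into I B"] by (intro f_inv_into_f) blast
  have "y (p i) = c\<^sup>2 * x i" if i: "i \<in> I" for i
  proof -
    have "2 \<le> card (I - {i})" using card i by simp
    then obtain j k where jk: "j \<in> I" "k \<in> I" "j \<noteq> i" "k \<noteq> i" "j \<noteq> k"
      by (auto simp: card_le_Suc_iff numeral_2_eq_2)
    have pI: "p i \<in> I" "p j \<in> I" "p k \<in> I" "p i \<noteq> p j" "p i \<noteq> p k" "p j \<noteq> p k"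
      using p i jk by (auto simp: bij_betw_def dest: inj_onD)
    have "y (p i) = (B (p j) - B (p i)) \<bullet> (B (p k) - B (p i))"
      using B.corner[OF pI] by simp
    also have "\<dots> = c\<^sup>2 * x i"
      unfolding Bp[OF i] Bp[OF jk(1)] Bp[OF jk(2)] using i jk by (intro F.corner) auto
    finally show ?thesis .
  qed
  then show ?thesis using that[of "c\<^sup>2" p] c p by simp
qed

text \<open>
  The edge vectors at one vertex form a basis. The linear map sending them to the corresponding
  edge vectors of the other simplex multiplies their inner products by \<open>c\<close>, hence all inner products,
  and so scales all distances by \<open>sqrt c\<close>.
\<close>

lemma proportional_imp_similar:
  fixes A B :: "'i \<Rightarrow> 'a::euclidean_space"
  assumes A: "weighted_simplex I x A" and B: "weighted_simplex I y B"
    and card: "card I = DIM('a) + 1"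
    and c: "0 < c" and scale: "\<And>i. i \<in> I \<Longrightarrow> y i = c * x i"
  shows "similar_sets (convex hull (A ` I)) (convex hull (B ` I))"
proof -
  interpret A: weighted_simplex I x A by (rule A)
  interpret B: weighted_simplex I y B by (rule B)
  obtain k where k: "k \<in> I" using card by fastforce
  define V where "V = (\<lambda>i. A i - A k) ` (I - {k})"
  have diff: "A ` I - {A k} = A ` (I - {k})"
    using inj_on_image_set_diff[OF A.inj, of I "{k}"] k by auto
  have "(\<lambda>v. - A k + v) ` (A ` I - {A k}) = V"
    unfolding diff V_def by (simp add: image_comp comp_def)
  then have indep: "independent V"
    using A.affine_independent affine_dependent_iff_dependent2[of "A k" "A ` I"] k by auto
  have "inj_on (\<lambda>i. A i - A k) (I - {k})"
    using A.inj by (auto simp: inj_on_def)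
  then have "card V = DIM('a)"
    using card k by (simp add: V_def card_image)
  then have span: "UNIV \<subseteq> span V"
    using card_ge_dim_independent[OF subset_UNIV indep] by simp
  obtain h where h: "linear h" and hV: "\<forall>v\<in>V. h v = B (inv_into I A (v + A k)) - B k"
    using linear_independent_extend[OF indep, of "\<lambda>v. B (inv_into I A (v + A k)) - B k"] by blast
  have hA: "h (A i - A k) = B i - B k" if "i \<in> I" for i
  proof (cases "i = k")
    case True then show ?thesis using linear_0[OF h] by simp
  next
    case False
    then show ?thesis using that hV by (simp add: V_def inv_into_f_f[OF A.inj])
  qed
  have inner_V: "h u \<bullet> h v = c * (u \<bullet> v)" if uv: "u \<in> V" "v \<in> V" for u v
  proof -
    obtain i j where i: "i \<in> I" "i \<noteq> k" "u = A i - A k" and j: "j \<in> I" "j \<noteq> k" "v = A j - A k"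
      using uv by (auto simp: V_def)
    have sq: "(A i - A k) \<bullet> (A i - A k) = x i + x k" "(B i - B k) \<bullet> (B i - B k) = y i + y k"
      using A.dist_sq[OF i(1) k i(2)] B.dist_sq[OF i(1) k i(2)]
      by (simp_all add: dist_norm power2_norm_eq_inner)
    show ?thesis
    proof (cases "i = j")
      case True
      then show ?thesis
        using i j k sq scale by (simp add: hA distrib_left)
    next
      case False
      then show ?thesis
        using i j k scale by (simp add: hA A.corner B.corner)
    qed
  qed
  have inner: "h u \<bullet> h v = c * (u \<bullet> v)" for u v
  proof (rule bilinear_eq[where f = "\<lambda>u v. h u \<bullet> h v" and g = "\<lambda>u v. c * (u \<bullet> v)"])
    show "bilinear (\<lambda>u v. h u \<bullet> h v)" "bilinear (\<lambda>u v. c * (u \<bullet> v))"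
      using h by (auto simp: bilinear_def linear_iff inner_add_left inner_add_right distrib_left)
    show "UNIV \<subseteq> span V" "UNIV \<subseteq> span V" by (rule span)+
  qed (auto intro: inner_V)
  define f where "f v = B k + h (v - A k)" for v
  have f: "\<forall>u v. dist (f u) (f v) = sqrt c * dist u v"
  proof (intro allI)
    fix u v
    have "f u - f v = h (u - v)" using h by (simp add: f_def linear_diff)
    then show "dist (f u) (f v) = sqrt c * dist u v"
      by (simp add: dist_norm norm_eq_sqrt_inner inner real_sqrt_mult)
  qed
  have fA: "f ` A ` I = B ` I"
    unfolding image_comp by (intro image_cong refl) (simp add: f_def hA)
  have "f ` (convex hull (A ` I)) = convex hull (B ` I)"
    using similarity_convex_hull[OF _ f] c fA by simp
  then show ?thesis
    unfolding similar_sets_def using f c by (intro exI[of _ f] exI[of _ "sqrt c"]) simp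
qed

section \<open>Realising given weights\<close>

text \<open>
  All vertices but one, \<open>A k\<close>, are placed on the coordinate axes at distance \<open>sqrt (x i)\<close> from the
  origin. The distances from \<open>A k\<close> to the others force the \<open>i\<close>-th coordinate of \<open>A k\<close> to be
  \<open>s / sqrt (x i)\<close> with one number \<open>s\<close>, and then only a quadratic equation for \<open>s\<close> remains.
\<close>

lemma weighted_simplex_exists:
  assumes card: "card I = DIM('a::euclidean_space) + 1" and pos: "\<And>i. i \<in> I \<Longrightarrow> 0 < x i"
  obtains A :: "'i \<Rightarrow> 'a::euclidean_space" where "weighted_simplex I x A"
proof -
  have fin: "finite I" using card by (auto intro: card_ge_0_finite)
  obtain k where k: "k \<in> I" using card by fastforce
  let ?J = "I - {k}"
  have "card ?J = card (Basis :: 'a set)" using card k by simp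
  then obtain e :: "'i \<Rightarrow> 'a" where e: "bij_betw e ?J Basis"
    using finite_same_card_bij[of ?J "Basis :: 'a set"] fin by auto
  have ee: "e i \<bullet> e j = (if i = j then 1 else 0)" if "i \<in> ?J" "j \<in> ?J" for i j
  proof -
    have "e i \<in> Basis" "e j \<in> Basis" using bij_betw_apply[OF e] that by auto
    moreover have "e i = e j \<longleftrightarrow> i = j"
      using inj_on_eq_iff[OF bij_betw_imp_inj_on[OF e]] that by blast
    ultimately show ?thesis by (simp add: inner_Basis)
  qed
  define S where "S = (\<Sum>j\<in>?J. 1 / x j)"
  have "?J \<noteq> {}" using card k by (metis DIM_positive One_nat_def add_diff_cancel_right' card.empty
        card_Diff_singleton less_irrefl)
  then have S: "0 < S" unfolding S_def using fin pos by (intro sum_pos) auto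
  define s where "s = (1 - sqrt (1 + S * x k)) / S"
  have s: "s\<^sup>2 * S - 2 * s = x k"
  proof -
    have "(1 - S * s)\<^sup>2 = 1 + S * x k"
      using S pos[OF k] by (simp add: s_def)
    then have "S * (s\<^sup>2 * S - 2 * s) = S * x k"
      by (simp add: power2_eq_square algebra_simps)
    then show ?thesis using S by simp
  qed
  define v where "v = (\<Sum>j\<in>?J. (s / sqrt (x j)) *\<^sub>R e j)"
  define A where "A i = (if i = k then v else sqrt (x i) *\<^sub>R e i)" for i
  have ve: "v \<bullet> e i = s / sqrt (x i)" if "i \<in> ?J" for i
  proof -
    have "v \<bullet> e i = (\<Sum>j\<in>?J. if j = i then s / sqrt (x j) else 0)"
      unfolding v_def inner_sum_left using that by (intro sum.cong refl) (auto simp: ee)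
    then show ?thesis using that fin by simp
  qed
  have vv: "v \<bullet> v = s\<^sup>2 * S"
  proof -
    have "v \<bullet> v = (\<Sum>j\<in>?J. (s / sqrt (x j)) * (v \<bullet> e j))"
      by (subst (2) v_def) (simp add: inner_sum_right)
    also have "\<dots> = (\<Sum>j\<in>?J. s\<^sup>2 * (1 / x j))"
    proof (intro sum.cong refl)
      fix j assume j: "j \<in> ?J"
      then have "0 < x j" using pos by blast
      then show "(s / sqrt (x j)) * (v \<bullet> e j) = s\<^sup>2 * (1 / x j)"
        using ve[OF j] by (simp add: power2_eq_square)
    qed
    finally show ?thesis by (simp add: S_def sum_distrib_left)
  qed
  have with_k: "(dist (A k) (A i))\<^sup>2 = x k + x i" if "i \<in> ?J" for i
  proof -
    have xi: "0 < x i" using that pos by blast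
    have "(dist (A k) (A i))\<^sup>2 = v \<bullet> v - 2 * sqrt (x i) * (v \<bullet> e i) + (sqrt (x i))\<^sup>2 * (e i \<bullet> e i)"
      using that unfolding power2_norm_eq_inner dist_norm power2_eq_square[of "sqrt (x i)"]
      by (simp add: A_def inner_diff_left inner_diff_right inner_commute)
    then show ?thesis using xi that s by (simp add: vv ve ee)
  qed
  have "weighted_simplex I x A"
  proof
    fix i j assume ij: "i \<in> I" "j \<in> I" "i \<noteq> j"
    consider "i = k" | "j = k" | "i \<in> ?J" "j \<in> ?J" using ij by blast
    then show "(dist (A i) (A j))\<^sup>2 = x i + x j"
    proof cases
      case 1 then show ?thesis using with_k[of j] ij by simp
    next
      case 2 then show ?thesis using with_k[of i] ij by (simp add: dist_commute)
    next
      case 3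
      then have "0 < x i" "0 < x j" using pos by auto
      then show ?thesis using 3 ij ee[of i j] ee[of j i]
        by (simp add: A_def dist_norm power2_norm_eq_inner inner_diff_left inner_diff_right ee)
    qed
  qed (use fin pos in auto)
  then show ?thesis by (rule that)
qed

section \<open>Edge lengths of an orthocentric simplex\<close>

text \<open>
  With the orthocenter \<open>H\<close> as origin, perpendicularity of the altitudes says that all inner products
  of two different vertices have one value \<open>s\<close>. Taking the inner product of
  \<open>(\<Sum>i\<in>I. a i *\<^sub>R (A i - H)) = 0\<close> with \<open>A j - H\<close> gives
  \<open>a j * ((A j - H) \<bullet> (A j - H) - s) = - s\<close>. Here \<open>s \<noteq> 0\<close>: otherwise some vertex
  equals \<open>H\<close>, and the simplex is rectangular. So
  each vertex has a weight inversely proportional to its barycentric coordinate, with \<open>\<sigma> = - s\<close>.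
\<close>

lemma orthocenter_edge_lengths:
  fixes A :: "'i \<Rightarrow> 'a::euclidean_space"
  assumes inj: "inj_on A I" and indep: "\<not> affine_dependent (A ` I)" and card: "3 \<le> card I"
    and H: "is_orthocenter H (convex hull (A ` I))"
    and a1: "sum a I = 1" and aH: "(\<Sum>i\<in>I. a i *\<^sub>R A i) = H"
    and nrect: "\<not> rectangular (convex hull (A ` I))"
  obtains \<sigma> :: real
    where "\<And>i j. i \<in> I \<Longrightarrow> j \<in> I \<Longrightarrow> i \<noteq> j \<Longrightarrow> (dist (A i) (A j))\<^sup>2 = \<sigma> / a i + \<sigma> / a j"
proof -
  have fin: "finite I" using card by (auto intro: card_ge_0_finite)
  have verts: "vertices (convex hull (A ` I)) = A ` I"
    by (simp add: vertices_def extreme_point_of_convex_hull_affine_independent[OF indep])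
  define g where "g i j = (A i - H) \<bullet> (A j - H)" for i j
  have sym: "g i j = g j i" for i j by (simp add: g_def inner_commute)
  \<comment> \<open>That \<open>H\<close> lies on the altitude of \<open>A i\<close> makes the off-diagonal entries of row \<open>i\<close> equal;
     symmetry of \<open>g\<close> then links the rows.\<close>
  have row: "g i j = g i k" if "i \<in> I" "j \<in> I" "k \<in> I" "i \<noteq> j" "i \<noteq> k" for i j k
  proof -
    have "A j \<in> affine hull (A ` I - {A i})" "A k \<in> affine hull (A ` I - {A i})"
      using that inj by (auto intro!: hull_inc dest: inj_onD)
    then have "(H - A i) \<bullet> (A j - A k) = 0"
      using H that unfolding is_orthocenter_def verts altitude_def by blast
    then show ?thesis by (simp add: g_def inner_diff_left inner_diff_right)
  qed
  obtain p q where pq: "p \<in> I" "q \<in> I" "p \<noteq> q"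
    using card by (auto simp: card_le_Suc_iff numeral_3_eq_3)
  define s where "s = g p q"
  have g: "g i j = s" if ij: "i \<in> I" "j \<in> I" "i \<noteq> j" for i j
  proof (cases "i = p")
    case True then show ?thesis using row[of p j q] ij pq by (simp add: s_def)
  next
    case False
    then have "g i j = g p i" using row[of i j p] ij pq sym by simp
    also have "\<dots> = s" using row[of p i q] False ij pq by (simp add: s_def)
    finally show ?thesis .
  qed
  have diag: "a j * (g j j - s) = - s" if j: "j \<in> I" for j
  proof -
    have "(\<Sum>i\<in>I. a i *\<^sub>R (A i - H)) = 0"
      using a1 aH by (simp add: scaleR_diff_right sum_subtractf flip: scaleR_sum_left)
    then have "0 = (\<Sum>i\<in>I. a i *\<^sub>R (A i - H)) \<bullet> (A j - H)" by simp
    also have "\<dots> = (\<Sum>i\<in>I. a i * g i j)"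
      by (simp add: inner_sum_left g_def)
    also have "\<dots> = (\<Sum>i\<in>I. a i * s + (if i = j then a j * (g j j - s) else 0))"
      by (intro sum.cong refl) (auto simp: g j algebra_simps)
    also have "\<dots> = s + a j * (g j j - s)"
      using fin j a1 by (simp add: sum.distrib flip: sum_distrib_right)
    finally show ?thesis by simp
  qed
  have s0: "s \<noteq> 0"
  proof
    assume "s = 0"
    obtain j where j: "j \<in> I" "a j \<noteq> 0"
      using a1 by (metis sum.neutral zero_neq_one)
    then have "g j j = 0" using diag[OF j(1)] \<open>s = 0\<close> by simp
    then have "A j = H" by (simp add: g_def)
    then have "H \<in> A ` I" using j by blast
    then show False using nrect H by (auto simp: rectangular_def verts)
  qed
  have a0: "a j \<noteq> 0" if "j \<in> I" for j using diag[OF that] s0 by auto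
  have "(dist (A i) (A j))\<^sup>2 = (- s) / a i + (- s) / a j" if ij: "i \<in> I" "j \<in> I" "i \<noteq> j" for i j
  proof -
    have "(dist (A i) (A j))\<^sup>2 = g i i + g j j - 2 * g i j"
      by (simp add: g_def dist_norm power2_norm_eq_inner inner_diff_left inner_diff_right
          inner_commute)
    moreover have "g i i - s = (- s) / a i" "g j j - s = (- s) / a j"
      using diag ij a0 by (simp_all add: field_simps)
    ultimately show ?thesis using g[OF ij] by simp
  qed
  then show ?thesis by (rule that)
qed

section \<open>Two blocks of equal weights\<close>

definition block_weight :: "nat \<Rightarrow> real \<Rightarrow> nat \<Rightarrow> real" where
  "block_weight m r i = (if i \<le> m then r else 1)"

text \<open>
  The equation for the ratio \<open>r\<close> of the two weights of an equiradial simplex, cleared of its denominator.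
\<close>

definition ratio_quadratic :: "nat \<Rightarrow> nat \<Rightarrow> real \<Rightarrow> real" where
  "ratio_quadratic d m r = (let n = real d + 1 - real m in
     n * (n - 1) * r\<^sup>2 - ((real d)\<^sup>2 - 3 * real d + 4 - 2 * (real m * n)) * r + real m * (real m - 1))"

lemma sum_blocks:
  fixes u v :: real
  assumes "m \<le> d"
  shows "(\<Sum>i=1..d+1. if i \<le> m then u else v) = real m * u + (real d + 1 - real m) * v"
proof -
  have "{1..d+1} \<inter> {i. i \<le> m} = {1..m}" "{1..d+1} \<inter> - {i. i \<le> m} = {m+1..d+1}"
    using assms by auto
  then have "(\<Sum>i=1..d+1. if i \<le> m then u else v) = (\<Sum>i=1..m. u) + (\<Sum>i=m+1..d+1. v)"
    by (simp only: sum.If_cases finite_atLeastAtMost)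
  also have "\<dots> = real m * u + (real d + 1 - real m) * v"
    using assms by (simp add: of_nat_diff del: sum.cl_ivl_Suc)
  finally show ?thesis .
qed

text \<open>
  Any positive weights that are constant on the first \<open>m\<close> indices and on the rest have this form. The scale \<open>c\<close> changes nothing up to
  similarity, but is present in a simplex that is given.
\<close>

locale block_simplex = weighted_simplex "{1..d+1}" "\<lambda>i. c * block_weight m r i" A
  for d m :: nat and c r :: real and A :: "nat \<Rightarrow> 'a::euclidean_space" +
  assumes m: "2 \<le> m" "m < d" and c: "0 < c" and r: "0 < r"
begin

lemma sum_inverse_weights:
  "(\<Sum>i=1..d+1. 1 / (c * block_weight m r i)) = (real m / r + (real d + 1 - real m)) / c"
proof -
  have "(\<Sum>i=1..d+1. 1 / (c * block_weight m r i)) = (\<Sum>i=1..d+1. if i \<le> m then 1 / (c * r) else 1 / c)"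
    by (intro sum.cong refl) (simp add: block_weight_def)
  also have "\<dots> = (real m / r + (real d + 1 - real m)) / c"
    using m by (subst sum_blocks) (simp_all add: add_divide_distrib)
  finally show ?thesis .
qed

lemma regular_iff: "regular_simplex (convex hull (A ` {1..d+1})) \<longleftrightarrow> r = 1"
proof
  assume "regular_simplex (convex hull (A ` {1..d+1}))"
  then obtain l where "\<forall>P\<in>A ` {1..d+1}. \<forall>Q\<in>A ` {1..d+1}. P \<noteq> Q \<longrightarrow> dist P Q = l"
    unfolding regular_simplex_def vertices_eq by (rule exE)
  then have l: "dist (A i) (A j) = l" if "i \<in> {1..d+1}" "j \<in> {1..d+1}" "A i \<noteq> A j" for i j
    using that by blast
  have ne: "A i \<noteq> A j" if "i \<in> {1..d+1}" "j \<in> {1..d+1}" "i \<noteq> j" for i j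
    using inj_onD[OF inj _ that(1,2)] that(3) by blast
  have l_sq: "l\<^sup>2 = c * block_weight m r i + c * block_weight m r j"
    if "i \<in> {1..d+1}" "j \<in> {1..d+1}" "i \<noteq> j" for i j
    unfolding dist_sq[OF that, symmetric] l[OF that(1,2) ne[OF that]] ..
  have "l\<^sup>2 = c * r + c * r"
    using l_sq[of 1 2] m by (simp add: block_weight_def)
  moreover have "l\<^sup>2 = c + c"
    using l_sq[of d "d+1"] m by (simp add: block_weight_def)
  ultimately show "r = 1" using c by simp
next
  assume "r = 1"
  then have "dist (A i) (A j) = sqrt (c + c)"
    if "i \<in> {1..d+1}" "j \<in> {1..d+1}" "A i \<noteq> A j" for i j
  proof -
    have "i \<noteq> j" using that(3) by blast
    then have "(dist (A i) (A j))\<^sup>2 = c + c"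
      using dist_sq[OF that(1,2)] \<open>r = 1\<close> by (simp add: block_weight_def)
    then show ?thesis by (metis real_sqrt_unique zero_le_dist)
  qed
  then show "regular_simplex (convex hull (A ` {1..d+1}))"
    unfolding regular_simplex_def vertices_eq by (intro exI[of _ "sqrt (c + c)"]) blast
qed

text \<open>
  For vertices from different blocks the equiradial condition reads
  \<open>(m + n * r - 1) * (m / r + n - 1) = (d - 2)\<^sup>2\<close> with \<open>n = d + 1 - m\<close>. Multiplication by \<open>r\<close> makes
  it the quadratic.
\<close>

lemma equiradial_iff_root:
  assumes r1: "r \<noteq> 1"
  shows "equiradial (convex hull (A ` {1..d+1})) \<longleftrightarrow> ratio_quadratic d m r = 0"
proof -
  let ?w = "\<lambda>i. c * block_weight m r i"
  define S where "S = (\<Sum>i=1..d+1. 1 / ?w i)"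
  define n where "n = real d + 1 - real m"
  define K where "K = (real d - 2)\<^sup>2"
  have "equiradial (convex hull (A ` {1..d+1})) \<longleftrightarrow>
      (\<forall>i\<in>{1..d+1}. \<forall>j\<in>{1..d+1}. ?w i \<noteq> ?w j \<longrightarrow> (S * ?w i - 1) * (S * ?w j - 1) = K)"
    using equiradial_iff m by (simp add: S_def K_def)
  also have "\<dots> \<longleftrightarrow> (S * (c * r) - 1) * (S * c - 1) = K"
  proof
    assume "\<forall>i\<in>{1..d+1}. \<forall>j\<in>{1..d+1}. ?w i \<noteq> ?w j \<longrightarrow> (S * ?w i - 1) * (S * ?w j - 1) = K"
    moreover have "1 \<in> {1..d+1}" "d+1 \<in> {1..d+1}" "?w 1 = c * r" "?w (d+1) = c" "c * r \<noteq> c"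
      using m c r1 by (auto simp: block_weight_def)
    ultimately show "(S * (c * r) - 1) * (S * c - 1) = K" by metis
  next
    assume "(S * (c * r) - 1) * (S * c - 1) = K"
    moreover from this have "(S * c - 1) * (S * (c * r) - 1) = K" by (simp only: mult.commute)
    ultimately show "\<forall>i\<in>{1..d+1}. \<forall>j\<in>{1..d+1}. ?w i \<noteq> ?w j \<longrightarrow> (S * ?w i - 1) * (S * ?w j - 1) = K"
      by (simp add: block_weight_def)
  qed
  also have "S * (c * r) = real m + n * r"
    unfolding S_def sum_inverse_weights using c r by (simp add: n_def field_simps)
  also have "S * c = real m / r + n"
    unfolding S_def sum_inverse_weights using c r by (simp add: n_def)
  also have "(m + n * r - 1) * (m / r + n - 1) = K \<longleftrightarrow> ((m + n * r - 1) * (m / r + n - 1)) * r = K * r"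
    using r by simp
  also have "((m + n * r - 1) * (m / r + n - 1)) * r = (m + n * r - 1) * (m + (n - 1) * r)"
    using r by (simp add: field_simps)
  also have "(m + n * r - 1) * (m + (n - 1) * r) = K * r \<longleftrightarrow> ratio_quadratic d m r = 0"
  proof -
    have "(m + n * r - 1) * (m + (n - 1) * r) - K * r = ratio_quadratic d m r"
      unfolding ratio_quadratic_def Let_def n_def K_def power2_eq_square by algebra
    then show ?thesis by auto
  qed
  finally show ?thesis .
qed

lemma special_simplex:
  assumes "r \<noteq> 1" "ratio_quadratic d m r = 0"
  shows "special_simplex d m (convex hull (A ` {1..d+1}))"
proof -
  let ?w = "\<lambda>i. c * block_weight m r i"
  define a where "a i = 1 / ((\<Sum>j=1..d+1. 1 / ?w j) * ?w i)" for i
  define H where "H = (\<Sum>i=1..d+1. a i *\<^sub>R A i)"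
  have o: "is_orthocenter H (convex hull (A ` {1..d+1}))"
    unfolding H_def a_def by (rule orthocenter) simp
  have "bij_betw A {1..d+1} (vertices (convex hull (A ` {1..d+1})))"
    unfolding vertices_eq using inj by (rule inj_on_imp_bij_betw)
  moreover have "(\<Sum>i=1..d+1. a i) = 1"
    unfolding a_def by (rule orthocenter_coordinates_sum) simp
  moreover have "\<forall>i\<in>{1..m}. \<forall>j\<in>{1..m}. a i = a j"
    "\<forall>i\<in>{m+1..d+1}. \<forall>j\<in>{m+1..d+1}. a i = a j"
    by (simp_all add: a_def block_weight_def)
  ultimately have "orthocenter_two_blocks d m (convex hull (A ` {1..d+1}))"
    unfolding orthocenter_two_blocks_def using o H_def[symmetric] by blast
  moreover have "\<not> rectangular (convex hull (A ` {1..d+1}))"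
    by (rule not_rectangular) (use m in simp)
  moreover have "int d simplex (convex hull (A ` {1..d+1}))"
    by (rule is_simplex) simp
  ultimately show ?thesis
    unfolding special_simplex_def orthocentric_def
    using o regular_iff assms equiradial_iff_root by blast
qed

end

text \<open>
  The edge lengths come from weights inversely proportional to the barycentric coordinates of the
  orthocenter. Each of the two blocks contains at least two vertices, and the edge joining them has
  twice the weight of the block as its squared length; so both weights are positive.
\<close>

lemma special_simplex_imp_block_simplex:
  fixes U :: "'a::euclidean_space set"
  assumes U: "special_simplex d m U" and m: "2 \<le> m" "m < d"
  obtains c r and A :: "nat \<Rightarrow> 'a"
    where "block_simplex d m c r A" "U = convex hull (A ` {1..d+1})"
      "r \<noteq> 1" "ratio_quadratic d m r = 0"
proof -
  let ?I = "{1..d+1}"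
  obtain C where indep: "\<not> affine_dependent C" and UC: "U = convex hull C"
    using U unfolding special_simplex_def simplex_def by blast
  have verts: "vertices U = C"
    by (simp add: UC vertices_def extreme_point_of_convex_hull_affine_independent[OF indep])
  have "orthocenter_two_blocks d m U"
    using U by (simp add: special_simplex_def)
  then obtain H A a where H: "is_orthocenter H U" and A: "bij_betw A ?I C"
    and a1: "sum a ?I = (1::real)" and aH: "(\<Sum>i\<in>?I. a i *\<^sub>R A i) = H"
    and blocks: "\<forall>i\<in>{1..m}. \<forall>j\<in>{1..m}. a i = a j"
      "\<forall>i\<in>{m+1..d+1}. \<forall>j\<in>{m+1..d+1}. a i = a j"
    unfolding orthocenter_two_blocks_def verts by (elim exE conjE) (rule that, assumption+)
  have inj: "inj_on A ?I" and C: "A ` ?I = C"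
    using A by (simp_all only: bij_betw_def)
  have UA: "U = convex hull (A ` ?I)" by (simp only: UC C)
  have nrect: "\<not> rectangular U" using U by (simp add: special_simplex_def)
  have "3 \<le> card ?I" using m by simp
  then obtain \<sigma> where \<sigma>: "\<And>i j. i \<in> ?I \<Longrightarrow> j \<in> ?I \<Longrightarrow> i \<noteq> j \<Longrightarrow> (dist (A i) (A j))\<^sup>2 = \<sigma> / a i + \<sigma> / a j"
    using orthocenter_edge_lengths[OF inj indep[folded C] _ H[unfolded UA] a1 aH nrect[unfolded UA]]
    by blast
  define X Y where "X = \<sigma> / a 1" and "Y = \<sigma> / a (d+1)"
  have w: "\<sigma> / a i = (if i \<le> m then X else Y)" if "i \<in> ?I" for i
  proof (cases "i \<le> m")
    case True
    then have "i \<in> {1..m}" "1 \<in> {1..m}" using that m by auto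
    then have "a i = a 1" using blocks(1) by blast
    then show ?thesis using True by (simp add: X_def)
  next
    case False
    then have "i \<in> {m+1..d+1}" "d+1 \<in> {m+1..d+1}" using that m by auto
    then have "a i = a (d+1)" using blocks(2) by blast
    then show ?thesis using False by (simp add: Y_def)
  qed
  have pos_edge: "0 < \<sigma> / a i + \<sigma> / a j" if "i \<in> ?I" "j \<in> ?I" "i \<noteq> j" for i j
    unfolding \<sigma>[OF that, symmetric] using inj_onD[OF inj _ that(1,2)] that(3) by auto
  have X: "0 < X" using pos_edge[of 1 2] w[of 1] w[of 2] m by simp
  have Y: "0 < Y" using pos_edge[of d "d+1"] w[of d] w[of "d+1"] m by simp
  interpret block_simplex d m Y "X / Y" A
  proof
    fix i j assume "i \<in> ?I" "j \<in> ?I" "i \<noteq> j"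
    then show "(dist (A i) (A j))\<^sup>2 = Y * block_weight m (X / Y) i + Y * block_weight m (X / Y) j"
      using \<sigma> w Y by (simp add: block_weight_def)
  qed (use X Y m in \<open>auto simp: block_weight_def\<close>)
  have r1: "X / Y \<noteq> 1"
    using U UA regular_iff by (simp add: special_simplex_def)
  moreover have "ratio_quadratic d m (X / Y) = 0"
    using U UA equiradial_iff_root[OF r1] by (simp add: special_simplex_def)
  ultimately show ?thesis using that block_simplex_axioms UA by blast
qed

text \<open>
  A similarity permutes the vertices and multiplies the weights by a constant \<open>c\<close>. There are
  \<open>d + 1 - m\<close> vertices of weight \<open>1\<close> after scaling. If \<open>c \<noteq> 1\<close>, they would come from the block of
  \<open>m\<close> vertices, which has a different size; so \<open>c = 1\<close> and the ratios agree.
\<close>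

lemma similar_block_simplices_ratio_eq:
  fixes A B :: "nat \<Rightarrow> 'a::euclidean_space"
  assumes A: "block_simplex d m b r A" and B: "block_simplex d m b' s B"
    and r1: "r \<noteq> 1" and s1: "s \<noteq> 1" and unbalanced: "2 * m \<noteq> d + 1"
    and sim: "similar_sets (convex hull (A ` {1..d+1})) (convex hull (B ` {1..d+1}))"
  shows "r = s"
proof -
  let ?I = "{1..d+1}"
  interpret A: block_simplex d m b r A by (rule A)
  interpret B: block_simplex d m b' s B by (rule B)
  have "3 \<le> card ?I" using A.m by simp
  then obtain e p where e: "0 < e" and p: "bij_betw p ?I ?I"
    and ep: "\<And>i. i \<in> ?I \<Longrightarrow> b' * block_weight m s (p i) = e * (b * block_weight m r i)"
    using similar_imp_proportional[OF A.weighted_simplex_axioms B.weighted_simplex_axioms _ sim]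
    by metis
  define c where "c = e * b / b'"
  have cw: "block_weight m s (p i) = c * block_weight m r i" if "i \<in> ?I" for i
    using ep[OF that] B.c by (simp add: c_def field_simps)
  have ones: "{j \<in> ?I. block_weight m s j = 1} = {m+1..d+1}"
    using s1 A.m by (auto simp: block_weight_def)
  have pI: "p ` ?I = ?I" and inj: "inj_on p ?I" using p by (simp_all only: bij_betw_def)
  have "{j \<in> ?I. block_weight m s j = 1} = {j \<in> p ` ?I. block_weight m s j = 1}"
    by (simp only: pI)
  also have "\<dots> = p ` {i \<in> ?I. block_weight m s (p i) = 1}" by blast
  also have "{i \<in> ?I. block_weight m s (p i) = 1} = {i \<in> ?I. c * block_weight m r i = 1}"
    using cw by auto
  finally have "p ` {i \<in> ?I. c * block_weight m r i = 1} = {m+1..d+1}" unfolding ones ..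
  then have card: "card {i \<in> ?I. c * block_weight m r i = 1} = d + 1 - m"
    using card_image[OF inj_on_subset[OF inj Collect_restrict], of "\<lambda>i. c * block_weight m r i = 1"]
    by (metis Suc_eq_plus1 card_atLeastAtMost diff_Suc_Suc)
  have c1: "c = 1"
  proof (rule ccontr)
    assume "c \<noteq> 1"
    then have "{i \<in> ?I. c * block_weight m r i = 1} = (if c * r = 1 then {1..m} else {})"
      using A.m by (auto simp: block_weight_def)
    then show False using card unbalanced A.m by (auto split: if_splits)
  qed
  have "block_weight m s (p 1) = r"
    using cw[of 1] c1 A.m by (simp add: block_weight_def)
  then show "r = s" using r1 by (simp add: block_weight_def split: if_splits)
qed

section \<open>The roots of the quadratic\<close>

text \<open>
  Since this value is not \<open>0\<close>, no root belongs to a regular simplex.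
\<close>

lemma ratio_quadratic_at_1:
  "ratio_quadratic d m 1 = 4 * (real d - 1)"
  unfolding ratio_quadratic_def Let_def power2_eq_square by algebra

text \<open>
  Equality in the bound would produce a double root, hence a single simplex. It cannot occur, for
  arithmetic reasons: \<open>d\<^sup>2 - 3 * d + 4 = (d - 2) * (d - 1) + 2\<close>, so equality makes \<open>d - 2\<close> a divisor of
  \<open>2\<close>. This leaves \<open>d = 4\<close> with \<open>m\<close> equal to \<open>2\<close> or \<open>3\<close>, where the two sides differ.
\<close>

lemma admissible_strict:
  assumes "admissible d m"
  shows "real m * (real d + 1 - real m) * (2 * (real d - 2))\<^sup>2 < ((real d)\<^sup>2 - 3 * real d + 4)\<^sup>2"
proof -
  have d: "3 < d" and m: "2 \<le> m" "m \<le> d - 1"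
    and le: "real m * (real d + 1 - real m) \<le> (((real d)\<^sup>2 - 3 * real d + 4) / (2 * (real d - 2)))\<^sup>2"
    using assms by (auto simp: admissible_def)
  have "0 < (2 * (real d - 2))\<^sup>2" using d by simp
  then have "real m * (real d + 1 - real m) * (2 * (real d - 2))\<^sup>2 \<le> ((real d)\<^sup>2 - 3 * real d + 4)\<^sup>2"
    using le unfolding power_divide by (simp add: pos_le_divide_eq)
  moreover have "real m * (real d + 1 - real m) * (2 * (real d - 2))\<^sup>2 \<noteq> ((real d)\<^sup>2 - 3 * real d + 4)\<^sup>2"
  proof
    assume "real m * (real d + 1 - real m) * (2 * (real d - 2))\<^sup>2 = ((real d)\<^sup>2 - 3 * real d + 4)\<^sup>2"
    then have "real_of_int (int m * (int d + 1 - int m) * (2 * (int d - 2))\<^sup>2) =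
        real_of_int (((int d)\<^sup>2 - 3 * int d + 4)\<^sup>2)" by simp
    then have eq: "int m * (int d + 1 - int m) * (2 * (int d - 2))\<^sup>2 = ((int d)\<^sup>2 - 3 * int d + 4)\<^sup>2"
      by (simp only: of_int_eq_iff)
    have "(int d - 2)\<^sup>2 dvd ((int d)\<^sup>2 - 3 * int d + 4)\<^sup>2"
      unfolding eq[symmetric] power_mult_distrib by (intro dvd_mult dvd_refl)
    then have "int d - 2 dvd (int d)\<^sup>2 - 3 * int d + 4" by simp
    moreover have "(int d)\<^sup>2 - 3 * int d + 4 = (int d - 2) * (int d - 1) + 2"
      by (simp add: power2_eq_square algebra_simps)
    ultimately have "int d - 2 dvd 2" by (metis dvd_add_right_iff dvd_triv_left)
    then have "d = 4" using d zdvd_imp_le[of "int d - 2" 2] by simp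
    moreover from this have "m = 2 \<or> m = 3" using m by auto
    ultimately show False using eq by auto
  qed
  ultimately show ?thesis by simp
qed

lemma quadratic_two_positive_roots:
  fixes a b c :: real
  assumes a: "0 < a" and b: "0 < b" and c: "0 < c" and disc: "4 * a * c < b\<^sup>2"
  obtains r s where "0 < r" "0 < s" "r \<noteq> s" "\<And>t. a * t\<^sup>2 - b * t + c = 0 \<longleftrightarrow> t = r \<or> t = s"
proof -
  define D where "D = sqrt (b\<^sup>2 - 4 * a * c)"
  have D: "0 < D" "D\<^sup>2 = b\<^sup>2 - 4 * a * c" using disc by (simp_all add: D_def)
  have "D\<^sup>2 < b\<^sup>2" using D(2) a c by simp
  then have "D < b" using b by (simp add: power2_less_imp_less)
  have "a * t\<^sup>2 - b * t + c = 0 \<longleftrightarrow> t = (b + D) / (2 * a) \<or> t = (b - D) / (2 * a)" for t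
  proof -
    have "4 * a * (a * t\<^sup>2 - b * t + c) = (2 * a * t - b - D) * (2 * a * t - b + D)"
      using D(2) by (simp add: power2_eq_square algebra_simps)
    then have "a * t\<^sup>2 - b * t + c = 0 \<longleftrightarrow> 2 * a * t - b - D = 0 \<or> 2 * a * t - b + D = 0"
      using a by (metis mult_eq_0_iff less_numeral_extra(3) zero_neq_numeral)
    then show ?thesis using a by (simp add: field_simps)
  qed
  then show ?thesis
    using that[of "(b + D) / (2 * a)" "(b - D) / (2 * a)"] D(1) \<open>D < b\<close> a b by (simp add: field_simps)
qed

text \<open>
  Put \<open>Q = d\<^sup>2 - 3 * d + 4\<close>, \<open>n = d + 1 - m\<close> and \<open>p = m * n\<close>. The discriminant is
  \<open>(Q - 2 * p)\<^sup>2 - 4 * p * (p - d) = Q\<^sup>2 - 4 * p * (d - 2)\<^sup>2\<close>, which is positive exactly when the strict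
  form of the bound holds. The middle coefficient is \<open>- (Q - 2 * p)\<close>, and \<open>Q > 2 * p\<close> follows from the
  bound and \<open>Q \<ge> 2 * d\<close>; so both roots are positive.
\<close>

lemma admissible_roots:
  assumes adm: "admissible d m"
  obtains r s where "0 < r" "0 < s" "r \<noteq> s" "\<And>t. ratio_quadratic d m t = 0 \<longleftrightarrow> t = r \<or> t = s"
proof -
  define n where "n = real d + 1 - real m"
  define Q where "Q = (real d)\<^sup>2 - 3 * real d + 4"
  define p where "p = real m * n"
  have d: "4 \<le> real d" and m: "2 \<le> real m" "2 \<le> n"
    using adm by (auto simp: admissible_def n_def)
  have Qd: "Q - real d = (real d - 2)\<^sup>2" by (simp add: Q_def power2_eq_square algebra_simps)
  have "4 * p * (Q - real d) < Q\<^sup>2"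
  proof -
    have "4 * p * (Q - real d) = real m * (real d + 1 - real m) * (2 * (real d - 2))\<^sup>2"
      unfolding Qd p_def n_def by algebra
    then show ?thesis using admissible_strict[OF adm] by (simp only: Q_def)
  qed
  then have disc: "4 * (p * (p - real d)) < (Q - 2 * p)\<^sup>2"
    by (simp add: power2_eq_square algebra_simps)
  have "0 \<le> (real d - 1) * (real d - 4)" using d by simp
  then have "2 * real d \<le> Q" by (simp add: Q_def power2_eq_square algebra_simps)
  have "0 < Q - 2 * p"
  proof (rule ccontr)
    assume "\<not> 0 < Q - 2 * p"
    then have "Q \<le> 2 * p" by simp
    have "Q * Q \<le> (2 * p) * (2 * (Q - real d))"
      using \<open>2 * real d \<le> Q\<close> \<open>Q \<le> 2 * p\<close> d by (intro mult_mono) auto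
    then show False using \<open>4 * p * (Q - real d) < Q\<^sup>2\<close> by (simp add: power2_eq_square algebra_simps)
  qed
  moreover have "n * (n - 1) * (real m * (real m - 1)) = p * (p - real d)"
    unfolding p_def n_def by algebra
  ultimately obtain r s where "0 < r" "0 < s" "r \<noteq> s"
    "\<And>t. n * (n - 1) * t\<^sup>2 - (Q - 2 * p) * t + real m * (real m - 1) = 0 \<longleftrightarrow> t = r \<or> t = s"
    using quadratic_two_positive_roots[of "n * (n - 1)" "Q - 2 * p" "real m * (real m - 1)"] m disc
    by (auto simp: mult.assoc)
  then show ?thesis
    using that[of r s] by (simp add: ratio_quadratic_def Let_def n_def p_def Q_def)
qed

text \<open>
  For blocks of equal size the two roots would be reciprocal and their simplices similar. But for
  \<open>m = (d + 1) / 2\<close> the bound becomes \<open>(d + 1) * (d - 2) < d\<^sup>2 - 3 * d + 4\<close>, which means \<open>d < 3\<close>.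
\<close>

lemma admissible_unbalanced:
  assumes adm: "admissible d m"
  shows "2 * m \<noteq> d + 1"
proof
  assume "2 * m = d + 1"
  then have "real (2 * m) = real (d + 1)" by simp
  then have m: "real m = (real d + 1) / 2" by simp
  have d: "4 \<le> real d" using adm by (simp add: admissible_def)
  have "((real d + 1) * (real d - 2))\<^sup>2 < ((real d)\<^sup>2 - 3 * real d + 4)\<^sup>2"
    using admissible_strict[OF adm] unfolding m by (simp add: power2_eq_square field_simps)
  moreover have "0 \<le> (real d - 1) * (real d - 2) + 2" using d by simp
  then have "0 \<le> (real d)\<^sup>2 - 3 * real d + 4" by (simp add: power2_eq_square algebra_simps)
  ultimately have "(real d + 1) * (real d - 2) < (real d)\<^sup>2 - 3 * real d + 4"
    by (rule power2_less_imp_less)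
  then show False using d by (simp add: power2_eq_square algebra_simps)
qed

section \<open>Counting the simplices\<close>

lemma admissible_imp_exactly_two:
  assumes dim: "DIM('a::euclidean_space) = d" and adm: "admissible d m"
  shows "exactly_two_up_to_similarity (special_simplex d m :: 'a set \<Rightarrow> bool)"
proof -
  let ?I = "{1..d+1}"
  have m: "2 \<le> m" "m < d" "3 < d" using adm by (auto simp: admissible_def)
  obtain r s where rs: "0 < r" "0 < s" "r \<noteq> s"
    and roots: "\<And>t. ratio_quadratic d m t = 0 \<longleftrightarrow> t = r \<or> t = s"
    using admissible_roots[OF adm] by blast
  have "ratio_quadratic d m 1 \<noteq> 0" using m by (simp add: ratio_quadratic_at_1)
  then have ne1: "r \<noteq> 1" "s \<noteq> 1" using roots by auto
  have ex: "\<exists>A :: nat \<Rightarrow> 'a. block_simplex d m 1 t A" if "0 < t" for t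
  proof -
    have "card ?I = DIM('a) + 1" using dim by simp
    moreover have "0 < 1 * block_weight m t i" for i using that by (simp add: block_weight_def)
    ultimately obtain A :: "nat \<Rightarrow> 'a" where "weighted_simplex ?I (\<lambda>i. 1 * block_weight m t i) A"
      using weighted_simplex_exists[of ?I "\<lambda>i. 1 * block_weight m t i"] by blast
    then show ?thesis
      using that m by (auto simp: block_simplex_def block_simplex_axioms_def)
  qed
  obtain A B :: "nat \<Rightarrow> 'a" where A: "block_simplex d m 1 r A" and B: "block_simplex d m 1 s B"
    using ex rs by blast
  let ?S = "convex hull (A ` ?I)" and ?T = "convex hull (B ` ?I)"
  have "special_simplex d m ?S" "special_simplex d m ?T"
    using block_simplex.special_simplex[OF A] block_simplex.special_simplex[OF B] ne1 roots by auto
  moreover have "\<not> similar_sets ?S ?T"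
    using similar_block_simplices_ratio_eq[OF A B ne1 admissible_unbalanced[OF adm]] rs by blast
  moreover have "similar_sets U ?S \<or> similar_sets U ?T" if U: "special_simplex d m U" for U :: "'a set"
  proof -
    obtain c t D where D: "block_simplex d m c t D" and UD: "U = convex hull (D ` ?I)"
      and t: "ratio_quadratic d m t = 0"
      using special_simplex_imp_block_simplex[OF U m(1,2)] by metis
    have c: "0 < c" using D by (simp add: block_simplex_def block_simplex_axioms_def)
    have sim: "similar_sets U (convex hull (E ` ?I))" if E: "block_simplex d m 1 t E" for E :: "nat \<Rightarrow> 'a"
      unfolding UD
    proof (rule proportional_imp_similar[where c = "1 / c"])
      show "weighted_simplex ?I (\<lambda>i. c * block_weight m t i) D"
        "weighted_simplex ?I (\<lambda>i. 1 * block_weight m t i) E"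
        using D E by (simp_all only: block_simplex_def)
    qed (use dim c in auto)
    show ?thesis using t roots sim[of A] sim[of B] A B by auto
  qed
  ultimately show ?thesis unfolding exactly_two_up_to_similarity_def by blast
qed

text \<open>
  The right-hand side of the bound is at least \<open>((d - 1) / 2)\<^sup>2\<close>, because
  \<open>d\<^sup>2 - 3 * d + 4 \<ge> (d - 1) * (d - 2)\<close>.
\<close>

lemma admissible_if_square_le:
  assumes "3 < d" "2 \<le> m" "m \<le> d - 1" "4 * (real m * (real d + 1 - real m)) \<le> (real d - 1)\<^sup>2"
  shows "admissible d m"
proof -
  have "(real d - 1) / 2 \<le> ((real d)\<^sup>2 - 3 * real d + 4) / (2 * (real d - 2))"
    using assms(1) by (simp add: field_simps power2_eq_square)
  then have "((real d - 1) / 2)\<^sup>2 \<le> (((real d)\<^sup>2 - 3 * real d + 4) / (2 * (real d - 2)))\<^sup>2"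
    using assms(1) by (intro power_mono) auto
  moreover have "real m * (real d + 1 - real m) \<le> ((real d - 1) / 2)\<^sup>2"
    using assms(4) by (simp add: power_divide)
  ultimately show ?thesis
    unfolding admissible_def using assms(1-3) by simp
qed

lemma admissible_large:
  assumes "2 \<le> m" "4 * m + 4 \<le> d"
  shows "admissible d m"
proof (rule admissible_if_square_le)
  have d: "4 * real m + 4 \<le> real d" using assms(2) by linarith
  then have "(4 * real m + 4) * real d \<le> real d * real d" by (intro mult_right_mono) auto
  moreover have "(real d - 1)\<^sup>2 - 4 * (real m * (real d + 1 - real m)) =
      (real d * real d - (4 * real m + 4) * real d) + (2 * real d + 1 - 4 * real m) + 4 * (real m * real m)"
    by (simp add: power2_eq_square algebra_simps)
  moreover have "0 \<le> real m * real m" by simp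
  ultimately show "4 * (real m * (real d + 1 - real m)) \<le> (real d - 1)\<^sup>2"
    using d by linarith
qed (use assms in auto)

lemma admissible_2:
  assumes "9 \<le> d"
  shows "admissible d 2"
proof (rule admissible_if_square_le)
  have "0 \<le> (real d - 1) * (real d - 9)" using assms by simp
  then show "4 * (real 2 * (real d + 1 - real 2)) \<le> (real d - 1)\<^sup>2"
    by (simp add: power2_eq_square algebra_simps)
qed (use assms in auto)

theorem theorem4p11:
  fixes d :: nat
  assumes "DIM('a::euclidean_space) = d"
  shows "(\<forall>m. admissible d m \<longrightarrow>
            exactly_two_up_to_similarity (special_simplex d m :: 'a set \<Rightarrow> bool)) \<and>
         (\<forall>m\<ge>2. \<exists>D. (\<forall>k\<ge>D. admissible k m) \<and>
            (d \<ge> D \<longrightarrow> exactly_two_up_to_similarity (special_simplex d m :: 'a set \<Rightarrow> bool))) \<and>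
         (\<forall>k\<ge>9. admissible k 2) \<and>
         (d \<ge> 9 \<longrightarrow> exactly_two_up_to_similarity (special_simplex d 2 :: 'a set \<Rightarrow> bool))"
proof -
  note two = admissible_imp_exactly_two[OF assms]
  have "\<exists>D. (\<forall>k\<ge>D. admissible k m) \<and>
      (d \<ge> D \<longrightarrow> exactly_two_up_to_similarity (special_simplex d m :: 'a set \<Rightarrow> bool))"
    if "2 \<le> m" for m
    using admissible_large[OF that] two by (intro exI[of _ "4 * m + 4"]) blast
  then show ?thesis using two admissible_2 by blast
qed

end
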